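(* Let $N,K\in\mathbb{N}_0$. The energy equation for the stochastic Galerkin shallow water linearised moment equations (SGSWLME) defined in the context, with unknowns $\boldsymbol{\hat h},\boldsymbol{\hat q_0},\ldots,\boldsymbol{\hat q_N}$ and $\boldsymbol{\hat u_j}=\mathcal{P}(\boldsymbol{\hat h})^{-1}\boldsymbol{\hat q_j}$ for $j=0,\ldots,N$, reads $$\partial_t\left(\frac{g\,\boldsymbol{\hat h}^T\boldsymbol{\hat h}}{2}+\frac12\sum_{j=0}^N\frac{\boldsymbol{\hat u_j}^T\mathcal{P}(\boldsymbol{\hat h})\boldsymbol{\hat u_j}}{2j+1}\right)+\partial_x\left(g\,\boldsymbol{\hat h}^T\mathcal{P}(\boldsymbol{\hat h})\boldsymbol{\hat u_0}+\frac12\sum_{j=0}^N\frac{\boldsymbol{\hat u_j}^T\mathcal{P}(\boldsymbol{\hat q_0})\boldsymbol{\hat u_j}}{2j+1}+\sum_{j=1}^N\frac{\boldsymbol{\hat u_j}^T\mathcal{P}(\boldsymbol{\hat q_j})\boldsymbol{\hat u_0}}{2j+1}\right)$$ $$=-\sum_{i,j=0}^N\frac{(2j+1)\,\boldsymbol{\hat u_i}^TT\boldsymbol{\hat u_j}}{\lambda}-4\sum_{i,j=1}^N(2j+1)\,a_{i,j}\,\boldsymbol{\hat u_i}^TT\,\mathcal{P}(\boldsymbol{\hat h})^{-1}\boldsymbol{\hat u_j}.$$ This means that the total energy is given by $e=\frac{g\boldsymbol{\hat h}^T\boldsymbol{\hat h}}{2}+\frac12\sum_{j=0}^N\frac{\boldsymbol{\hat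 u_j}^T\mathcal{P}(\boldsymbol{\hat h})\boldsymbol{\hat u_j}}{2j+1}$ and the energy flux is equal to $f=g\boldsymbol{\hat h}^T\mathcal{P}(\boldsymbol{\hat h})\boldsymbol{\hat u_0}+\frac12\sum_{j=0}^N\frac{\boldsymbol{\hat u_j}^T\mathcal{P}(\boldsymbol{\hat q_0})\boldsymbol{\hat u_j}}{2j+1}+\sum_{j=1}^N\frac{\boldsymbol{\hat u_j}^T\mathcal{P}(\boldsymbol{\hat q_j})\boldsymbol{\hat u_0}}{2j+1}$.
   Context: Let $\xi$ be a real random variable with continuous distribution function, finite moments of all orders, and distribution uniquely determined by its moments. Let $\psi_0,\psi_1,\ldots$ be the polynomials orthonormal with respect to the distribution of $\xi$ ($\deg\psi_k=k$), and let $\langle\cdot\rangle$ denote expectation. They satisfy a three-term recurrence $\psi_{k+1}(\xi)=(\alpha_k\xi+\beta_k)\psi_k(\xi)+\gamma_k\psi_{k-1}(\xi)$ with $\alpha_k\neq0$ and $\psi_{-1}=0$. For $k=0,\ldots,K$ let $\mathcal{M}_k\in\mathbb{R}^{(K+1)\times(K+1)}$ be the symmetric matrix $(\mathcal{M}_k)_{lm}=\langle\psi_k\psi_l\psi_m\rangle$, $0\le l,m\le K$. For $\boldsymbol{\hat\eta}=(\hat\eta_0,\ldots,\hat\eta_K)^T\in\mathbb{R}^{K+1}$ define $\mathcal{P}(\boldsymbol{\hat\eta})=\sum_{k=0}^K\hat\eta_k\mathcal{M}_k$. It is assumed that $\mathcal{P}(\boldsymbol{\hat h})$ is invertible. The uncertain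 friction coefficient is $\nu=\mu+\sigma\xi$ with constants $\mu,\sigma$. $T$ is the $(K+1)\times(K+1)$ tridiagonal matrix (indices $0,\ldots,K$) with entries $T_{k,k}=\mu-\sigma\beta_k/\alpha_k$, $T_{k+1,k}=\sigma/\alpha_k$, $T_{k-1,k}=-\sigma\gamma_k/\alpha_k$, and zero otherwise. The constant $g$ is the gravitational constant and $\lambda$ the slip length. The constants $a_{i,j}$ are $a_{i,j}=0$ if $i+j$ is odd and $a_{i,j}=\frac{\min(i,j)(\min(i,j)+1)}{2}$ if $i+j$ is even. With $\boldsymbol{\hat u_j}=\mathcal{P}(\boldsymbol{\hat h})^{-1}\boldsymbol{\hat q_j}$, the SGSWLME are the system, for unknowns $\boldsymbol{\hat h},\boldsymbol{\hat q_0},\ldots,\boldsymbol{\hat q_N}$ depending on $(t,x)$ with values in $\mathbb{R}^{K+1}$, $$\partial_t\boldsymbol{\hat h}+\partial_x\boldsymbol{\hat q_0}=\boldsymbol 0,$$ $$\partial_t\boldsymbol{\hat q_0}+\partial_x\Big(\tfrac g2\mathcal{P}(\boldsymbol{\hat h})\boldsymbol{\hat h}+\sum_{j=0}^N\tfrac{\mathcal{P}(\boldsymbol{\hat q_j})\boldsymbol{\hat u_j}}{2j+1}\Big)=-\tfrac{1}{\lambda}T\sum_{j=0}^N\boldsymbol{\hat u_j},$$ and for $i=1,\ldots,N$ $$\partial_t\boldsymbol{\hat q_i}+\partial_x\big(\mathcal{P}(\boldsymbol{\hat q_0})\boldsymbol{\hat u_i}+\mathcal{P}(\boldsymbol{\hat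 q_i})\boldsymbol{\hat u_0}\big)=\mathcal{P}(\boldsymbol{\hat u_0})\partial_x\boldsymbol{\hat q_i}-\tfrac{2i+1}{\lambda}T\sum_{j=0}^N\boldsymbol{\hat u_j}-4(2i+1)T\sum_{j=1}^Na_{i,j}\mathcal{P}(\boldsymbol{\hat h})^{-1}\boldsymbol{\hat u_j}.$$
   Formalization: The factor (2j+1) is removed from both sums on the right-hand side: for N ≥ 1 the printed equation is false (K=0, N=1, μ=1, σ=0, λ=1/5, h=1, u_0=5e^{-2t}, u_1=-3e^{-2t} gives -56 on the left and -68 on the right at t=0). *)

theory Defs
  imports
    "HOL-Probability.Probability"
    "HOL-Computational_Algebra.Polynomial"
begin

section \<open>Orthonormal polynomials of a random variable\<close>

definition moment_determinate :: "real measure \<Rightarrow> bool" where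
  "moment_determinate \<rho> \<longleftrightarrow>
     (\<forall>\<rho>'. real_distribution \<rho>' \<and>
        (\<forall>n::nat. integrable \<rho>' (\<lambda>x. x ^ n) \<and> (LINT x|\<rho>'. x ^ n) = (LINT x|\<rho>. x ^ n))
        \<longrightarrow> \<rho>' = \<rho>)"

definition admissible_germ :: "'w measure \<Rightarrow> ('w \<Rightarrow> real) \<Rightarrow> bool" where
  "admissible_germ M \<xi> \<longleftrightarrow>
     prob_space M \<and> \<xi> \<in> borel_measurable M \<and>
     continuous_on UNIV (cdf (distr M borel \<xi>)) \<and>
     (\<forall>n::nat. integrable M (\<lambda>\<omega>. \<xi> \<omega> ^ n)) \<and>
     moment_determinate (distr M borel \<xi>)"

definition orthonormal_polys :: "'w measure \<Rightarrow> ('w \<Rightarrow> real) \<Rightarrow> (nat \<Rightarrow> real poly) \<Rightarrow> bool" where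
  "orthonormal_polys M \<xi> \<psi> \<longleftrightarrow>
     (\<forall>k. degree (\<psi> k) = k) \<and>
     (\<forall>k l. (LINT \<omega>|M. poly (\<psi> k) (\<xi> \<omega>) * poly (\<psi> l) (\<xi> \<omega>)) = (if k = l then 1 else 0))"

text \<open>The convention \<open>\<psi>\<^sub>-\<^sub>1 = 0\<close> is the case distinction on \<open>k = 0\<close>; hence \<open>\<gamma> 0\<close> is irrelevant.\<close>

definition three_term_recurrence ::
    "(nat \<Rightarrow> real poly) \<Rightarrow> (nat \<Rightarrow> real) \<Rightarrow> (nat \<Rightarrow> real) \<Rightarrow> (nat \<Rightarrow> real) \<Rightarrow> bool" where
  "three_term_recurrence \<psi> \<alpha> \<beta> \<gamma> \<longleftrightarrow>
     (\<forall>k. \<alpha> k \<noteq> 0 \<and>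
        (\<forall>x. poly (\<psi> (k + 1)) x =
              (\<alpha> k * x + \<beta> k) * poly (\<psi> k) x + \<gamma> k * (if k = 0 then 0 else poly (\<psi> (k - 1)) x)))"

section \<open>Galerkin matrices\<close>

text \<open>
  Vectors in \<open>K + 1\<close> real components are elements of \<open>real ^ 'k\<close> for a finite linearly ordered
  type with \<open>CARD('k) = K + 1\<close>. The rank \<open>idx\<close> is the order isomorphism onto \<open>{0, ..., K}\<close>,
  so \<open>v $ i\<close> is the component of \<open>v\<close> with number \<open>idx i\<close>.
\<close>

definition idx :: "'k::{finite,linorder} \<Rightarrow> nat" where
  "idx i = card {j. j < i}"

lemma idx_less_iff: "idx i < idx j \<longleftrightarrow> i < (j :: 'k::{finite,linorder})"
proof -
  have *: "idx a < idx b" if "a < b" for a b :: 'k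
    unfolding idx_def using that by (intro psubset_card_mono) auto
  show ?thesis using * by (metis less_asym less_irrefl linorder_less_linear)
qed

lemma bij_betw_idx:
  assumes "CARD('k::{finite,linorder}) = K + 1"
  shows "bij_betw (idx :: 'k \<Rightarrow> nat) UNIV {0..K}"
proof -
  have inj: "inj (idx :: 'k \<Rightarrow> nat)"
    by (rule injI) (metis idx_less_iff less_irrefl linorder_less_linear)
  have "idx i < CARD('k)" for i :: 'k
    unfolding idx_def by (rule psubset_card_mono) auto
  then have "range (idx :: 'k \<Rightarrow> nat) \<subseteq> {0..K}"
    using assms by (auto simp: less_Suc_eq_le)
  moreover have "card (range (idx :: 'k \<Rightarrow> nat)) = card {0..K}"
    using inj assms by (simp add: card_image)
  ultimately show ?thesis
    using inj by (simp add: bij_betw_def card_subset_eq)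
qed

definition galerkin_matrix ::
    "'w measure \<Rightarrow> ('w \<Rightarrow> real) \<Rightarrow> (nat \<Rightarrow> real poly) \<Rightarrow> nat \<Rightarrow> real ^ ('k::{finite,linorder}) ^ ('k::{finite,linorder})" where
  "galerkin_matrix M \<xi> \<psi> k =
     (\<chi> l m. LINT \<omega>|M. poly (\<psi> k) (\<xi> \<omega>) * poly (\<psi> (idx l)) (\<xi> \<omega>) * poly (\<psi> (idx m)) (\<xi> \<omega>))"

definition galerkin_product ::
    "'w measure \<Rightarrow> ('w \<Rightarrow> real) \<Rightarrow> (nat \<Rightarrow> real poly) \<Rightarrow>
     real ^ ('k::{finite,linorder}) \<Rightarrow> real ^ ('k::{finite,linorder}) ^ ('k::{finite,linorder})" where
  "galerkin_product M \<xi> \<psi> \<eta> = (\<Sum>k\<in>UNIV. (\<eta> $ k) *\<^sub>R galerkin_matrix M \<xi> \<psi> (idx k))"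

text \<open>The matrix of multiplication by \<open>\<nu> = \<mu> + \<sigma> \<xi>\<close> truncated to degree \<open>K\<close>; \<open>i\<close> is the row.\<close>

definition friction_matrix ::
    "real \<Rightarrow> real \<Rightarrow> (nat \<Rightarrow> real) \<Rightarrow> (nat \<Rightarrow> real) \<Rightarrow> (nat \<Rightarrow> real) \<Rightarrow>
     real ^ ('k::{finite,linorder}) ^ ('k::{finite,linorder})" where
  "friction_matrix \<mu> \<sigma> \<alpha> \<beta> \<gamma> =
     (\<chi> i j. if idx i = idx j then \<mu> - \<sigma> * \<beta> (idx j) / \<alpha> (idx j)
            else if idx i = idx j + 1 then \<sigma> / \<alpha> (idx j)
            else if idx i + 1 = idx j then - \<sigma> * \<gamma> (idx j) / \<alpha> (idx j)
            else 0)"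

definition a_coeff :: "nat \<Rightarrow> nat \<Rightarrow> real" where
  "a_coeff i j = (if odd (i + j) then 0 else real (min i j * (min i j + 1)) / 2)"

section \<open>The moment system\<close>

text \<open>Functions of time and space are written \<open>F t x\<close>.\<close>

definition dt :: "(real \<Rightarrow> real \<Rightarrow> 'a::real_normed_vector) \<Rightarrow> real \<Rightarrow> real \<Rightarrow> 'a" where
  "dt F t x = vector_derivative (\<lambda>s. F s x) (at t)"

definition dx :: "(real \<Rightarrow> real \<Rightarrow> 'a::real_normed_vector) \<Rightarrow> real \<Rightarrow> real \<Rightarrow> 'a" where
  "dx F t x = vector_derivative (\<lambda>y. F t y) (at x)"

definition dt_exists :: "(real \<Rightarrow> real \<Rightarrow> 'a::real_normed_vector) \<Rightarrow> real \<Rightarrow> real \<Rightarrow> bool" where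
  "dt_exists F t x \<longleftrightarrow> (\<lambda>s. F s x) differentiable (at t)"

definition dx_exists :: "(real \<Rightarrow> real \<Rightarrow> 'a::real_normed_vector) \<Rightarrow> real \<Rightarrow> real \<Rightarrow> bool" where
  "dx_exists F t x \<longleftrightarrow> (\<lambda>y. F t y) differentiable (at x)"

definition velocity ::
    "(real ^ 'k \<Rightarrow> real ^ 'k ^ 'k) \<Rightarrow> (real \<Rightarrow> real \<Rightarrow> real ^ 'k) \<Rightarrow>
     (nat \<Rightarrow> real \<Rightarrow> real \<Rightarrow> real ^ 'k) \<Rightarrow> nat \<Rightarrow> real \<Rightarrow> real \<Rightarrow> real ^ 'k" where
  "velocity P h q j t x = matrix_inv (P (h t x)) *v q j t x"

text \<open>
  Classical solutions on a set \<open>D\<close> of points \<open>(t, x)\<close>. Only first partial derivatives of the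
  unknowns are required to exist; those of the fluxes then exist as well.
\<close>

definition SGSWLME_solution ::
    "real \<Rightarrow> real \<Rightarrow> nat \<Rightarrow> (real ^ 'k \<Rightarrow> real ^ 'k ^ 'k) \<Rightarrow> real ^ 'k ^ 'k \<Rightarrow> (real \<times> real) set \<Rightarrow>
     (real \<Rightarrow> real \<Rightarrow> real ^ 'k) \<Rightarrow> (nat \<Rightarrow> real \<Rightarrow> real \<Rightarrow> real ^ 'k) \<Rightarrow> bool" where
  "SGSWLME_solution g lam N P T D h q \<longleftrightarrow>
     (let u = velocity P h q in
      \<forall>(t, x) \<in> D.
        invertible (P (h t x)) \<and>
        dt_exists h t x \<and> dx_exists h t x \<and>
        (\<forall>j\<le>N. dt_exists (q j) t x \<and> dx_exists (q j) t x) \<and>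
        dt h t x + dx (q 0) t x = 0 \<and>
        dt (q 0) t x
          + dx (\<lambda>t x. (g / 2) *\<^sub>R (P (h t x) *v h t x)
                      + (\<Sum>j=0..N. (1 / (2 * real j + 1)) *\<^sub>R (P (q j t x) *v u j t x))) t x
          = - ((1 / lam) *\<^sub>R (T *v (\<Sum>j=0..N. u j t x))) \<and>
        (\<forall>i\<in>{1..N}.
          dt (q i) t x
            + dx (\<lambda>t x. P (q 0 t x) *v u i t x + P (q i t x) *v u 0 t x) t x
            = P (u 0 t x) *v dx (q i) t x
              - ((2 * real i + 1) / lam) *\<^sub>R (T *v (\<Sum>j=0..N. u j t x))
              - (4 * (2 * real i + 1)) *\<^sub>R
                  (T *v (\<Sum>j=1..N. a_coeff i j *\<^sub>R (matrix_inv (P (h t x)) *v u j t x)))))"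

section \<open>Energy\<close>

definition total_energy ::
    "real \<Rightarrow> nat \<Rightarrow> (real ^ 'k \<Rightarrow> real ^ 'k ^ 'k) \<Rightarrow> (real \<Rightarrow> real \<Rightarrow> real ^ 'k) \<Rightarrow>
     (nat \<Rightarrow> real \<Rightarrow> real \<Rightarrow> real ^ 'k) \<Rightarrow> real \<Rightarrow> real \<Rightarrow> real" where
  "total_energy g N P h q t x =
     (let u = velocity P h q in
      g * (h t x \<bullet> h t x) / 2
      + 1 / 2 * (\<Sum>j=0..N. (u j t x \<bullet> (P (h t x) *v u j t x)) / (2 * real j + 1)))"

definition energy_flux ::
    "real \<Rightarrow> nat \<Rightarrow> (real ^ 'k \<Rightarrow> real ^ 'k ^ 'k) \<Rightarrow> (real \<Rightarrow> real \<Rightarrow> real ^ 'k) \<Rightarrow>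
     (nat \<Rightarrow> real \<Rightarrow> real \<Rightarrow> real ^ 'k) \<Rightarrow> real \<Rightarrow> real \<Rightarrow> real" where
  "energy_flux g N P h q t x =
     (let u = velocity P h q in
      g * (h t x \<bullet> (P (h t x) *v u 0 t x))
      + 1 / 2 * (\<Sum>j=0..N. (u j t x \<bullet> (P (q 0 t x) *v u j t x)) / (2 * real j + 1))
      + (\<Sum>j=1..N. (u j t x \<bullet> (P (q j t x) *v u 0 t x)) / (2 * real j + 1)))"

text \<open>
  CORRECTION. The original display of the energy equation has, on its right-hand side, an additional
  factor \<open>2 * j + 1\<close> in both double sums. With that factor the equation fails for \<open>N \<ge> 1\<close>:
  the equation for \<open>q i\<close> is tested with \<open>u i / (2 * i + 1)\<close>, as the weights in the energy
  require, and this cancels the factor \<open>2 * i + 1\<close> in its friction terms.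
  Counterexample to the printed form: \<open>N = 1\<close>, \<open>K = 0\<close>, \<open>\<psi> 0 = 1\<close>, \<open>\<mu> = 1\<close>, \<open>\<sigma> = 0\<close>,
  \<open>lam = 1/5\<close>, \<open>h = 1\<close>, \<open>q 0 = 5 * exp (- 2 * t)\<close>, \<open>q 1 = - 3 * exp (- 2 * t)\<close> solves the
  system; at \<open>t = 0\<close> the energy has time derivative \<open>- 56\<close> and the flux has space derivative
  \<open>0\<close>, while the printed right-hand side is \<open>- 68\<close>. The factor is therefore omitted here, which
  makes no difference for \<open>N = 0\<close>.
\<close>

definition energy_source ::
    "real \<Rightarrow> nat \<Rightarrow> (real ^ 'k \<Rightarrow> real ^ 'k ^ 'k) \<Rightarrow> real ^ 'k ^ 'k \<Rightarrow>
     (real \<Rightarrow> real \<Rightarrow> real ^ 'k) \<Rightarrow> (nat \<Rightarrow> real \<Rightarrow> real \<Rightarrow> real ^ 'k) \<Rightarrow> real \<Rightarrow> real \<Rightarrow> real" where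
  "energy_source lam N P T h q t x =
     (let u = velocity P h q in
      - (\<Sum>i=0..N. \<Sum>j=0..N. (u i t x \<bullet> (T *v u j t x)) / lam)
      - 4 * (\<Sum>i=1..N. \<Sum>j=1..N.
               a_coeff i j * (u i t x \<bullet> (T *v (matrix_inv (P (h t x)) *v u j t x)))))"

end

theory Submission
  imports Defs
begin

text \<open>
  All that is used of the Galerkin product is that \<open>a \<bullet> (P b *v c)\<close> is a totally symmetric
  trilinear form. Testing the equation of \<open>q j\<close> with \<open>u j / (2 * j + 1)\<close>, the one of \<open>h\<close> with
  \<open>g *\<^sub>R h\<close>, and using \<open>q j = P h *v u j\<close>, every term other than friction cancels against the
  product-rule expansion of the energy and its flux; the coupling of mode \<open>j\<close> to \<open>q 0\<close> in the
  momentum equation compensates the transport terms of mode \<open>j\<close>.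
\<close>

section \<open>Differentiability of solutions of linear systems depending on a parameter\<close>

lemma differentiable_prod:
  fixes f :: "'i \<Rightarrow> 'a::real_normed_vector \<Rightarrow> 'b::real_normed_field"
  assumes "\<And>i. i \<in> I \<Longrightarrow> f i differentiable (at x)"
  shows "(\<lambda>y. \<Prod>i\<in>I. f i y) differentiable (at x)"
  using assms by (induction I rule: infinite_finite_induct) (auto intro: differentiable_mult)

lemma differentiable_vec_componentwise:
  fixes f :: "'a::real_normed_vector \<Rightarrow> real ^ 'n"
  shows "f differentiable (at x) \<longleftrightarrow> (\<forall>i. (\<lambda>y. f y $ i) differentiable (at x))"
proof
  assume "f differentiable (at x)"
  then show "\<forall>i. (\<lambda>y. f y $ i) differentiable (at x)"
    unfolding differentiable_def
    by (blast intro: bounded_linear.has_derivative[OF bounded_linear_vec_nth])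
next
  assume "\<forall>i. (\<lambda>y. f y $ i) differentiable (at x)"
  then obtain F where "\<And>i. ((\<lambda>y. f y $ i) has_derivative F i) (at x)"
    unfolding differentiable_def by metis
  then have "(f has_derivative (\<lambda>y. \<chi> i. F i y)) (at x)"
    by (subst has_derivative_componentwise_within)
       (auto simp: Basis_vec_def inner_axis)
  then show "f differentiable (at x)"
    unfolding differentiable_def by blast
qed

text \<open>By the Leibniz formula the determinant is a polynomial in the entries.\<close>

lemma differentiable_det:
  fixes A :: "'a::real_normed_vector \<Rightarrow> real ^ 'n ^ 'n"
  assumes "\<And>i j. (\<lambda>y. A y $ i $ j) differentiable (at x)"
  shows "(\<lambda>y. det (A y)) differentiable (at x)"
  unfolding det_def
  by (auto intro!: differentiable_sum differentiable_mult differentiable_prod assms)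

lemma matrix_inv_mult_vec:
  fixes A :: "real ^ 'n ^ 'n"
  assumes "invertible A"
  shows "A *v (matrix_inv A *v b) = b"
proof -
  have "A ** matrix_inv A = mat 1"
    using assms unfolding invertible_def matrix_inv_def by (rule someI2_ex) simp
  then show ?thesis
    by (simp add: matrix_vector_mul_assoc)
qed

text \<open>The system provides derivatives of \<open>h\<close> and \<open>q j\<close> only; this
  lemma transfers them to the velocities. Cramer's rule writes each component of the solution as a
  quotient of determinants, with nonzero denominator at \<open>x\<close>. Invertibility is assumed
  near \<open>x\<close>, not only at \<open>x\<close>, because \<open>matrix_inv\<close> agrees with
  Cramer's quotient only where the matrix is invertible.\<close>

lemma differentiable_matrix_inv_mult_vec:
  fixes A :: "'a::real_normed_vector \<Rightarrow> real ^ 'n ^ 'n" and b :: "'a \<Rightarrow> real ^ 'n"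
  assumes A: "A differentiable (at x)" and b: "b differentiable (at x)"
    and inv: "eventually (\<lambda>y. invertible (A y)) (nhds x)"
  shows "(\<lambda>y. matrix_inv (A y) *v b y) differentiable (at x)"
proof -
  define c where
    "c y = (\<chi> k. det (\<chi> i j. if j = k then b y $ i else A y $ i $ j) / det (A y))" for y
  have A': "(\<lambda>y. A y $ i $ j) differentiable (at x)" for i j
  proof -
    have "bounded_linear (\<lambda>B :: real ^ 'n ^ 'n. B $ i $ j)"
      by (intro bounded_linear_compose[OF bounded_linear_vec_nth] bounded_linear_vec_nth)
    then show ?thesis
      using A bounded_linear.has_derivative unfolding differentiable_def by blast
  qed
  have b': "(\<lambda>y. b y $ i) differentiable (at x)" for i
    using b by (simp add: differentiable_vec_componentwise)
  have entries: "(\<lambda>y. if j = k then b y $ i else A y $ i $ j) differentiable (at x)" for i j k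
    by (cases "j = k") (simp_all add: A' b')
  have eq: "matrix_inv (A y) *v b y = c y" if "invertible (A y)" for y
    using cramer[of "A y" "matrix_inv (A y) *v b y" "b y"] matrix_inv_mult_vec[OF that] that
    by (simp add: c_def invertible_det_nz)
  have "det (A x) \<noteq> 0"
    using eventually_nhds_x_imp_x[OF inv] by (simp add: invertible_det_nz)
  then have "(\<lambda>y. c y $ k) differentiable (at x)" for k
    unfolding c_def
    by (simp, intro differentiable_divide differentiable_det) (simp_all add: A' entries)
  then have "c differentiable (at x)"
    by (simp add: differentiable_vec_componentwise)
  then obtain c' where c': "(c has_derivative c') (at x)"
    unfolding differentiable_def by blast
  have "((\<lambda>y. matrix_inv (A y) *v b y) has_derivative c') (at x)"
  proof (rule has_derivative_transform_eventually[OF c'])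
    show "\<forall>\<^sub>F y in at x. c y = matrix_inv (A y) *v b y"
      using inv by (auto simp: eventually_at_filter eq elim: eventually_mono)
    show "c x = matrix_inv (A x) *v b x"
      using eq eventually_nhds_x_imp_x[OF inv] by simp
  qed simp
  then show ?thesis
    unfolding differentiable_def by blast
qed

section \<open>Symmetric products and the energy balance of a single mode\<close>

locale symmetric_product =
  fixes P :: "real ^ 'k \<Rightarrow> real ^ 'k ^ 'k"
  assumes linear_P: "linear P"
    and comm: "P a *v b = P b *v a"
    and self_adjoint: "a \<bullet> (P b *v c) = c \<bullet> (P b *v a)"
begin

text \<open>Bilinear maps in finite dimension are bounded, which makes the product rule available
  for \<open>P a *v b\<close>.\<close>

lemma bounded_bilinear_P: "bounded_bilinear (\<lambda>a b. P a *v b)"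
proof -
  have "bilinear (\<lambda>a b. P a *v b)"
    unfolding bilinear_def
    by (auto intro!: linearI simp: linear_add[OF linear_P] linear_cmul[OF linear_P]
        matrix_vector_mult_add_rdistrib matrix_vector_right_distrib
        scaleR_matrix_vector_assoc matrix_vector_mult_scaleR)
  then show ?thesis
    by (simp add: bilinear_conv_bounded_bilinear)
qed

lemmas has_vector_derivative_P = bounded_bilinear.has_vector_derivative[OF bounded_bilinear_P]

lemma differentiable_velocity:
  fixes H Q :: "real \<Rightarrow> real ^ 'k"
  assumes H: "H differentiable (at s)" and Q: "Q differentiable (at s)"
    and inv: "eventually (\<lambda>r. invertible (P (H r))) (nhds s)"
  shows "(\<lambda>r. matrix_inv (P (H r)) *v Q r) differentiable (at s)"
proof (rule differentiable_matrix_inv_mult_vec[OF _ Q inv])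
  show "(\<lambda>r. P (H r)) differentiable (at s)"
    using H linear_P unfolding differentiable_def
    by (blast intro: bounded_linear.has_derivative linear_conv_bounded_linear[THEN iffD1])
qed


text \<open>Eliminates \<open>ut\<close>, for which there is no evolution equation, in favour of
  \<open>qt\<close>, for which there is one: symmetry of \<open>P h\<close> gives
  \<open>ut \<bullet> (P h *v u) = u \<bullet> (P h *v ut)\<close>, and the assumption replaces
  \<open>P h *v ut\<close> by \<open>qt - P ht *v u\<close>.\<close>

lemma kinetic_rate:
  assumes "qt = P h *v ut + P ht *v u"
  shows "u \<bullet> (P h *v ut + P ht *v u) + ut \<bullet> (P h *v u) = 2 * (u \<bullet> qt) - u \<bullet> (P ht *v u)"
  using self_adjoint[of ut h u] by (simp add: assms inner_add_right)

text \<open>\<open>F\<close> is the \<open>x\<close>-derivative of the contribution of the mode to the momentum flux.\<close>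

lemma mode_balance:
  assumes "qt = P h *v ut + P ht *v u"
    and "ht = - q0x"
    and "qt + ((P q0 *v ux + P q0x *v u) + (P q *v u0x + P qx *v u0)) = P u0 *v qx - S"
    and "F = P q *v ux + P qx *v u"
  shows "(u \<bullet> (P h *v ut + P ht *v u) + ut \<bullet> (P h *v u)) / 2
       + (u \<bullet> (P q0 *v ux + P q0x *v u) + ux \<bullet> (P q0 *v u)) / 2
       + (u \<bullet> (P q *v u0x + P qx *v u0) + ux \<bullet> (P q *v u0)) - u0 \<bullet> F = - (u \<bullet> S)"
proof -
  have "P ht *v u = - (P q0x *v u)"
    using assms(2) by (simp add: bounded_bilinear.minus_left[OF bounded_bilinear_P])
  moreover have "u \<bullet> qt = u \<bullet> (P u0 *v qx) - u \<bullet> S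
      - (u \<bullet> (P q0 *v ux) + u \<bullet> (P q0x *v u) + u \<bullet> (P q *v u0x) + u \<bullet> (P qx *v u0))"
    using arg_cong[OF assms(3), of "\<lambda>v. u \<bullet> v"] by (simp add: inner_simps)
  \<comment> \<open>These two terms are what testing leaves besides friction: the first comes from
    differentiating the coupling flux, the second is the nonconservative term, since
    \<open>P u0 *v qx = P qx *v u0\<close> by \<open>comm\<close>.\<close>
  moreover have "u0 \<bullet> F = ux \<bullet> (P q *v u0) + u \<bullet> (P qx *v u0)"
    using self_adjoint by (simp add: assms(4) inner_simps)
  ultimately show ?thesis
    using self_adjoint[of ux q0 u] comm[of u0 qx]
    unfolding kinetic_rate[OF assms(1)] by (simp add: inner_simps field_simps)
qed

text \<open>Mass conservation cancels \<open>g * (h \<bullet> ht)\<close> against the part of the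
  potential flux derivative in which \<open>h\<close> is not differentiated; the remaining
  \<open>g * (hx \<bullet> (P h *v u))\<close> cancels against the pressure term by
  self-adjointness. \<open>F\<close> is free here: it will collect the momentum fluxes of the higher
  modes, and \<open>u \<bullet> F\<close> is the term with opposite sign in
  \<open>mode_balance\<close>.\<close>

lemma momentum_balance:
  assumes "q0t = P h *v ut + P ht *v u"
    and "ht = - q0x"
    and "q0x = P h *v ux + P hx *v u"
    and "q0t + (g *\<^sub>R (P h *v hx) + ((P q0 *v ux + P q0x *v u) + F)) = - S"
  shows "g * (h \<bullet> ht) + g * (h \<bullet> (P h *v ux + P hx *v u) + hx \<bullet> (P h *v u))
       + (u \<bullet> (P h *v ut + P ht *v u) + ut \<bullet> (P h *v u)) / 2
       + (u \<bullet> (P q0 *v ux + P q0x *v u) + ux \<bullet> (P q0 *v u)) / 2 + u \<bullet> F = - (u \<bullet> S)"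
proof -
  have "P ht *v u = - (P q0x *v u)"
    using assms(2) by (simp add: bounded_bilinear.minus_left[OF bounded_bilinear_P])
  moreover have "u \<bullet> q0t = - (u \<bullet> S)
      - (g * (u \<bullet> (P h *v hx)) + u \<bullet> (P q0 *v ux) + u \<bullet> (P q0x *v u) + u \<bullet> F)"
    using arg_cong[OF assms(4), of "\<lambda>v. u \<bullet> v"] by (simp add: inner_simps)
  moreover have "g * (h \<bullet> ht) = - (g * (h \<bullet> (P h *v ux + P hx *v u)))"
    unfolding assms(2,3) by (simp add: inner_simps algebra_simps)
  ultimately show ?thesis
    using self_adjoint[of ux q0 u] self_adjoint[of hx h u]
    unfolding kinetic_rate[OF assms(1)] by (simp add: inner_simps field_simps)
qed

section \<open>The energy equation for an arbitrary symmetric product\<close>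

lemma energy_equation:
  assumes "open D" and sol: "SGSWLME_solution g lam N P T D h q" and tx: "(t, x) \<in> D"
  shows "dt_exists (total_energy g N P h q) t x"
    and "dx_exists (energy_flux g N P h q) t x"
    and "dt (total_energy g N P h q) t x + dx (energy_flux g N P h q) t x
           = energy_source lam N P T h q t x"
proof -
  define u where "u = velocity P h q"
  define w where "w j = 1 / (2 * real j + 1)" for j :: nat
  note sol' = sol[unfolded SGSWLME_solution_def Let_def, folded u_def]
  have inv: "invertible (P (h s y))" if "(s, y) \<in> D" for s y
    using sol' that by blast
  have qu: "q j s y = P (h s y) *v u j s y" if "(s, y) \<in> D" for j s y
    unfolding u_def velocity_def using inv[OF that] by (simp add: matrix_inv_mult_vec)
  \<comment> \<open>Openness of \<open>D\<close> keeps short segments through the point in both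
    coordinate directions inside \<open>D\<close>, so identities valid on \<open>D\<close> may be
    differentiated along them.\<close>
  have near_t: "\<forall>\<^sub>F s in nhds t. (s, x) \<in> D" and near_x: "\<forall>\<^sub>F y in nhds x. (t, y) \<in> D"
  proof -
    have "open ((\<lambda>s. (s, x)) -` D)" "open ((\<lambda>y. (t, y)) -` D)"
      using \<open>open D\<close> by (auto intro!: open_vimage continuous_intros)
    with tx show "\<forall>\<^sub>F s in nhds t. (s, x) \<in> D" "\<forall>\<^sub>F y in nhds x. (t, y) \<in> D"
      unfolding eventually_nhds by blast+
  qed

  define H where "H = h t x"
  define Q where "Q j = q j t x" for j
  define U where "U j = u j t x" for j
  define ht where "ht = dt h t x"
  define hx where "hx = dx h t x"
  define qt where "qt j = dt (q j) t x" for j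
  define qx where "qx j = dx (q j) t x" for j
  define ut where "ut j = dt (u j) t x" for j
  define ux where "ux j = dx (u j) t x" for j

  have ht: "((\<lambda>s. h s x) has_vector_derivative ht) (at t)"
    and hx: "((\<lambda>y. h t y) has_vector_derivative hx) (at x)"
    and qt: "j \<le> N \<Longrightarrow> ((\<lambda>s. q j s x) has_vector_derivative qt j) (at t)"
    and qx: "j \<le> N \<Longrightarrow> ((\<lambda>y. q j t y) has_vector_derivative qx j) (at x)" for j
    using sol' tx
    by (auto simp: ht_def hx_def qt_def qx_def dt_def dx_def dt_exists_def dx_exists_def
        vector_derivative_works[symmetric])
  have ut: "((\<lambda>s. u j s x) has_vector_derivative ut j) (at t)" if "j \<le> N" for j
    unfolding ut_def dt_def u_def velocity_def
    using near_t differentiableI_vector[OF ht] differentiableI_vector[OF qt[OF that]]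
    by (intro vector_derivative_works[THEN iffD1] differentiable_velocity)
       (auto elim!: eventually_mono simp: inv)
  have ux: "((\<lambda>y. u j t y) has_vector_derivative ux j) (at x)" if "j \<le> N" for j
    unfolding ux_def dx_def u_def velocity_def
    using near_x differentiableI_vector[OF hx] differentiableI_vector[OF qx[OF that]]
    by (intro vector_derivative_works[THEN iffD1] differentiable_velocity)
       (auto elim!: eventually_mono simp: inv)

  \<comment> \<open>The relation \<open>q j = P h *v u j\<close> holds along such a segment, so the
    given derivative of \<open>q j\<close> must equal the one from the product rule.\<close>
  have qt_eq: "qt j = P H *v ut j + P ht *v U j" if "j \<le> N" for j
  proof (rule vector_derivative_unique_at[OF qt[OF that]])
    have "\<forall>\<^sub>F s in nhds t. q j s x = P (h s x) *v u j s x"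
      using near_t by eventually_elim (rule qu)
    then show "((\<lambda>s. q j s x) has_vector_derivative P H *v ut j + P ht *v U j) (at t)"
      using has_vector_derivative_P[OF ht ut[OF that]]
      by (subst has_vector_derivative_cong_ev) (auto simp: H_def U_def qu[OF tx] elim: eventually_mono)
  qed
  have qx_eq: "qx j = P H *v ux j + P hx *v U j" if "j \<le> N" for j
  proof (rule vector_derivative_unique_at[OF qx[OF that]])
    have "\<forall>\<^sub>F y in nhds x. q j t y = P (h t y) *v u j t y"
      using near_x by eventually_elim (rule qu)
    then show "((\<lambda>y. q j t y) has_vector_derivative P H *v ux j + P hx *v U j) (at x)"
      using has_vector_derivative_P[OF hx ux[OF that]]
      by (subst has_vector_derivative_cong_ev) (auto simp: H_def U_def qu[OF tx] elim: eventually_mono)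
  qed

  define F where "F j = P (Q j) *v ux j + P (qx j) *v U j" for j
  \<comment> \<open>\<open>S\<close> is the slip friction common to all modes, and
    \<open>R i\<close> carries the coupling through \<open>a_coeff\<close>. Both omit the factor
    \<open>2 * i + 1\<close> of the moment equations, to be cancelled later by
    \<open>w i\<close>.\<close>
  define S where "S = (1 / lam) *\<^sub>R (T *v (\<Sum>j=0..N. U j))"
  define R where "R i = (T *v (\<Sum>j=1..N. a_coeff i j *\<^sub>R (matrix_inv (P H) *v U j)))" for i

  have mass: "ht = - qx 0"
    using sol' tx by (auto simp: ht_def qx_def eq_neg_iff_add_eq_0)
  have F: "((\<lambda>y. P (q j t y) *v u j t y) has_vector_derivative F j) (at x)" if "j \<le> N" for j
    unfolding F_def Q_def U_def by (rule has_vector_derivative_P[OF qx ux]) (fact that)+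
  have momentum: "qt 0 + (g *\<^sub>R (P H *v hx) + (\<Sum>j=0..N. w j *\<^sub>R F j)) = - S"
  proof -
    have "((\<lambda>y. (g / 2) *\<^sub>R (P (h t y) *v h t y)
          + (\<Sum>j=0..N. (1 / (2 * real j + 1)) *\<^sub>R (P (q j t y) *v u j t y))) has_vector_derivative
        (g / 2) *\<^sub>R (P H *v hx + P hx *v H) + (\<Sum>j=0..N. w j *\<^sub>R F j)) (at x)"
      unfolding H_def w_def
      by (intro has_vector_derivative_add has_vector_derivative_sum
          bounded_linear.has_vector_derivative[OF bounded_linear_scaleR_right]
          has_vector_derivative_P hx F) auto
    \<comment> \<open>Both terms of the product rule coincide by \<open>comm\<close>, which turns
      \<open>g / 2\<close> into \<open>g\<close>.\<close>
    moreover have "(g / 2) *\<^sub>R (P H *v hx + P hx *v H) = g *\<^sub>R (P H *v hx)"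
      by (simp add: comm[of hx] flip: scaleR_2)
    ultimately have "dx (\<lambda>t x. (g / 2) *\<^sub>R (P (h t x) *v h t x)
          + (\<Sum>j=0..N. (1 / (2 * real j + 1)) *\<^sub>R (P (q j t x) *v u j t x))) t x
        = g *\<^sub>R (P H *v hx) + (\<Sum>j=0..N. w j *\<^sub>R F j)"
      unfolding dx_def by (simp add: vector_derivative_at)
    then show ?thesis
      using sol' tx by (fastforce simp: S_def qt_def U_def)
  qed
  have moment: "qt i + ((P (Q 0) *v ux i + P (qx 0) *v U i) + (P (Q i) *v ux 0 + P (qx i) *v U 0))
      = P (U 0) *v qx i - (2 * real i + 1) *\<^sub>R (S + 4 *\<^sub>R R i)" if "i \<in> {1..N}" for i
  proof -
    have "dx (\<lambda>t x. P (q 0 t x) *v u i t x + P (q i t x) *v u 0 t x) t x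
        = (P (Q 0) *v ux i + P (qx 0) *v U i) + (P (Q i) *v ux 0 + P (qx i) *v U 0)"
      unfolding dx_def Q_def U_def using that
      by (intro vector_derivative_at has_vector_derivative_add has_vector_derivative_P qx ux) auto
    moreover have "dt (q i) t x
            + dx (\<lambda>t x. P (q 0 t x) *v u i t x + P (q i t x) *v u 0 t x) t x
            = P (u 0 t x) *v dx (q i) t x
              - ((2 * real i + 1) / lam) *\<^sub>R (T *v (\<Sum>j=0..N. u j t x))
              - (4 * (2 * real i + 1)) *\<^sub>R
                  (T *v (\<Sum>j=1..N. a_coeff i j *\<^sub>R (matrix_inv (P (h t x)) *v u j t x)))"
      using sol' tx that by blast
    ultimately show ?thesis
      by (simp add: S_def R_def qt_def qx_def U_def H_def scaleR_add_right mult.commute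
          diff_diff_eq)
  qed

  \<comment> \<open>The product-rule derivatives of the numerators in energy and flux are kept
    unsimplified, in the shape in which the two balance lemmas state them.\<close>
  define kt where "kt j = U j \<bullet> (P H *v ut j + P ht *v U j) + ut j \<bullet> (P H *v U j)" for j
  define kx where
    "kx j = U j \<bullet> (P (Q 0) *v ux j + P (qx 0) *v U j) + ux j \<bullet> (P (Q 0) *v U j)" for j
  define cx where
    "cx j = U j \<bullet> (P (Q j) *v ux 0 + P (qx j) *v U 0) + ux j \<bullet> (P (Q j) *v U 0)" for j
  define gx where "gx = H \<bullet> (P H *v ux 0 + P hx *v U 0) + hx \<bullet> (P H *v U 0)"
  note inner_derivative = bounded_bilinear.has_vector_derivative[OF bounded_bilinear_inner]

  have et: "((\<lambda>s. total_energy g N P h q s x) has_vector_derivative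
      g * (H \<bullet> ht) + 1 / 2 * (\<Sum>j=0..N. kt j / (2 * real j + 1))) (at t)"
  proof -
    have "((\<lambda>s. total_energy g N P h q s x) has_vector_derivative
      g * (H \<bullet> ht + ht \<bullet> H) / 2 + 1 / 2 * (\<Sum>j=0..N. kt j / (2 * real j + 1))) (at t)"
      unfolding total_energy_def Let_def u_def[symmetric] kt_def H_def U_def
      by (intro has_vector_derivative_add has_vector_derivative_sum has_vector_derivative_divide
          has_vector_derivative_mult_right inner_derivative has_vector_derivative_P ht ut) auto
    then show ?thesis
      by (simp add: inner_commute)
  qed
  have fx: "((\<lambda>y. energy_flux g N P h q t y) has_vector_derivative
      g * gx + 1 / 2 * (\<Sum>j=0..N. kx j / (2 * real j + 1)) + (\<Sum>j=1..N. cx j / (2 * real j + 1)))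
      (at x)"
    unfolding energy_flux_def Let_def u_def[symmetric] kx_def cx_def gx_def H_def U_def Q_def
    by (intro has_vector_derivative_add has_vector_derivative_sum has_vector_derivative_divide
        has_vector_derivative_mult_right inner_derivative has_vector_derivative_P hx ux qx) auto
  show "dt_exists (total_energy g N P h q) t x"
    unfolding dt_exists_def using et by (rule differentiableI_vector)
  show "dx_exists (energy_flux g N P h q) t x"
    unfolding dx_exists_def using fx by (rule differentiableI_vector)

  have zero: "g * (H \<bullet> ht) + g * gx + kt 0 / 2 + kx 0 / 2 + (\<Sum>j=1..N. w j * (U 0 \<bullet> F j))
      = - (U 0 \<bullet> S)"
  proof -
    \<comment> \<open>Since \<open>w 0 = 1\<close>, mode zero enters unweighted. \<open>F 0\<close>
      is its own advection term, and the remaining sum takes the place of \<open>F\<close> in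
      \<open>momentum_balance\<close>.\<close>
    have "(\<Sum>j=0..N. w j *\<^sub>R F j) = F 0 + (\<Sum>j=1..N. w j *\<^sub>R F j)"
      by (simp add: sum.atLeast_Suc_atMost w_def)
    then have "qt 0 + (g *\<^sub>R (P H *v hx)
        + ((P (Q 0) *v ux 0 + P (qx 0) *v U 0) + (\<Sum>j=1..N. w j *\<^sub>R F j))) = - S"
      using momentum by (simp add: F_def)
    from momentum_balance[OF qt_eq[of 0] mass qx_eq[of 0] this]
    show ?thesis
      by (simp add: gx_def kt_def kx_def inner_sum_right)
  qed
  have mode: "w i * (kt i / 2 + kx i / 2 + cx i - U 0 \<bullet> F i) = - (U i \<bullet> (S + 4 *\<^sub>R R i))"
    if "i \<in> {1..N}" for i
  proof -
    have "kt i / 2 + kx i / 2 + cx i - U 0 \<bullet> F i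
        = - (U i \<bullet> ((2 * real i + 1) *\<^sub>R (S + 4 *\<^sub>R R i)))"
      unfolding kt_def kx_def cx_def
      by (rule mode_balance[OF qt_eq mass moment F_def]) (use that in auto)
    \<comment> \<open>The weight of mode \<open>i\<close> in the energy cancels the factor of its
      friction terms, hence no such factor in \<open>energy_source\<close>.\<close>
    moreover have "w i * ((2 * real i + 1) * r) = r" for r
      by (simp add: w_def)
    ultimately show ?thesis
      by (simp only: inner_scaleR_right mult_minus_right)
  qed
  have split: "(\<Sum>j=0..N. f j / (2 * real j + 1)) = f 0 + (\<Sum>j=1..N. w j * f j)"
    for f :: "nat \<Rightarrow> real"
    by (simp add: sum.atLeast_Suc_atMost w_def)
  have "(\<Sum>j=1..N. w j * (kt j / 2 + kx j / 2 + cx j - U 0 \<bullet> F j))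
      = (\<Sum>j=1..N. w j * kt j) / 2 + (\<Sum>j=1..N. w j * kx j) / 2
        + (\<Sum>j=1..N. w j * cx j) - (\<Sum>j=1..N. w j * (U 0 \<bullet> F j))"
    by (simp add: ring_distribs sum.distrib sum_subtractf sum_divide_distrib)
  moreover have "(\<Sum>j=1..N. cx j / (2 * real j + 1)) = (\<Sum>j=1..N. w j * cx j)"
    by (simp add: w_def)
  \<comment> \<open>The sum of \<open>w j * (U 0 \<bullet> F j)\<close> is added and subtracted: one
    copy completes the balance of mode zero, the other those of the higher modes.\<close>
  ultimately have "dt (total_energy g N P h q) t x + dx (energy_flux g N P h q) t x
      = (g * (H \<bullet> ht) + g * gx + kt 0 / 2 + kx 0 / 2 + (\<Sum>j=1..N. w j * (U 0 \<bullet> F j)))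
        + (\<Sum>j=1..N. w j * (kt j / 2 + kx j / 2 + cx j - U 0 \<bullet> F j))"
    unfolding dt_def dx_def vector_derivative_at[OF et] vector_derivative_at[OF fx] split
    by (simp add: add_divide_distrib)
  also have "\<dots> = - (U 0 \<bullet> S) - (\<Sum>i=1..N. U i \<bullet> (S + 4 *\<^sub>R R i))"
    by (simp only: zero mode sum_negf add_uminus_conv_diff cong: sum.cong)
  \<comment> \<open>The slip friction of mode zero joins that of the others; \<open>R\<close>
    contributes only from mode one on.\<close>
  also have "\<dots> = - (\<Sum>i=0..N. U i \<bullet> S) - 4 * (\<Sum>i=1..N. U i \<bullet> R i)"
    by (simp add: sum.atLeast_Suc_atMost inner_add_right sum.distrib sum_distrib_left)
  also have "\<dots> = energy_source lam N P T h q t x"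
  proof -
    have "U i \<bullet> S = (\<Sum>j=0..N. (U i \<bullet> (T *v U j)) / lam)" for i
      by (simp add: S_def linear_sum[OF matrix_vector_mul_linear] inner_sum_right
          sum_divide_distrib)
    moreover have "U i \<bullet> R i
        = (\<Sum>j=1..N. a_coeff i j * (U i \<bullet> (T *v (matrix_inv (P H) *v U j))))" for i
      by (simp add: R_def linear_sum[OF matrix_vector_mul_linear] inner_sum_right
          matrix_vector_mult_scaleR)
    ultimately show ?thesis
      unfolding energy_source_def Let_def u_def[symmetric] U_def H_def by simp
  qed
  finally show "dt (total_energy g N P h q) t x + dx (energy_flux g N P h q) t x
      = energy_source lam N P T h q t x" .
qed

end

section \<open>Symmetry of the Galerkin product\<close>

lemma galerkin_product_mult_vec_nth:
  "(galerkin_product M \<xi> \<psi> a *v b) $ l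
     = (\<Sum>k\<in>UNIV. \<Sum>m\<in>UNIV. a $ k * b $ m * galerkin_matrix M \<xi> \<psi> (idx k) $ l $ m)"
  unfolding galerkin_product_def matrix_vector_mult_def
  by (simp add: sum_distrib_left sum_distrib_right mult_ac) (rule sum.swap)

text \<open>The integrand is a commutative product of three polynomials. These two exchanges
  generate all permutations of the three indices.\<close>

lemma galerkin_matrix_swap:
  "galerkin_matrix M \<xi> \<psi> (idx k) $ l $ m = galerkin_matrix M \<xi> \<psi> (idx m) $ l $ k"
  "galerkin_matrix M \<xi> \<psi> (idx k) $ l $ m = galerkin_matrix M \<xi> \<psi> (idx k) $ m $ l"
  by (simp_all add: galerkin_matrix_def mult_ac)

text \<open>Commutativity is the exchange of the two summation indices together with the first
  symmetry of the triple products; self-adjointness is the symmetry of each Galerkin matrix, the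
  second one.\<close>

lemma symmetric_product_galerkin:
  "symmetric_product (galerkin_product M \<xi> \<psi> :: real ^ 'k::{finite,linorder} \<Rightarrow> _)"
proof (rule symmetric_product.intro)
  show "linear (galerkin_product M \<xi> \<psi> :: real ^ 'k::{finite,linorder} \<Rightarrow> _)"
    by (rule linearI)
       (simp_all add: galerkin_product_def scaleR_left_distrib sum.distrib scaleR_sum_right)
  fix a b c :: "real ^ 'k::{finite,linorder}"
  have "(galerkin_product M \<xi> \<psi> a *v b) $ l = (galerkin_product M \<xi> \<psi> b *v a) $ l" for l
    unfolding galerkin_product_mult_vec_nth
    by (subst sum.swap, subst galerkin_matrix_swap(1)) (simp add: mult_ac)
  then show "galerkin_product M \<xi> \<psi> a *v b = galerkin_product M \<xi> \<psi> b *v a"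
    by (simp add: vec_eq_iff)
  have "transpose (galerkin_product M \<xi> \<psi> b) = galerkin_product M \<xi> \<psi> b"
    by (simp add: vec_eq_iff transpose_def galerkin_product_def galerkin_matrix_swap(2))
  then show "a \<bullet> (galerkin_product M \<xi> \<psi> b *v c) = c \<bullet> (galerkin_product M \<xi> \<psi> b *v a)"
    by (metis dot_lmul_matrix inner_commute transpose_matrix_vector)
qed

theorem theorem5p1:
  fixes N K :: nat
    and M :: "'w measure" and \<xi> :: "'w \<Rightarrow> real"
    and \<psi> :: "nat \<Rightarrow> real poly" and \<alpha> \<beta> \<gamma> :: "nat \<Rightarrow> real"
    and \<mu> \<sigma> g lam :: real
    and P :: "real ^ ('k::{finite,linorder}) \<Rightarrow> real ^ ('k::{finite,linorder}) ^ ('k::{finite,linorder})"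
    and T :: "real ^ ('k::{finite,linorder}) ^ ('k::{finite,linorder})"
    and D :: "(real \<times> real) set"
    and h :: "real \<Rightarrow> real \<Rightarrow> real ^ ('k::{finite,linorder})"
    and q :: "nat \<Rightarrow> real \<Rightarrow> real \<Rightarrow> real ^ ('k::{finite,linorder})"
  assumes "CARD('k) = K + 1"
    and "admissible_germ M \<xi>"
    and "orthonormal_polys M \<xi> \<psi>"
    and "three_term_recurrence \<psi> \<alpha> \<beta> \<gamma>"
    and "P = galerkin_product M \<xi> \<psi>"
    and "T = friction_matrix \<mu> \<sigma> \<alpha> \<beta> \<gamma>"
    and "lam \<noteq> 0"
    and "open D"
    and "SGSWLME_solution g lam N P T D h q"
  shows "\<forall>(t, x) \<in> D.
           dt_exists (total_energy g N P h q) t x \<and>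
           dx_exists (energy_flux g N P h q) t x \<and>
           dt (total_energy g N P h q) t x + dx (energy_flux g N P h q) t x
             = energy_source lam N P T h q t x"
  using symmetric_product.energy_equation[OF symmetric_product_galerkin assms(8)]
    assms(9) unfolding assms(5) by auto

end
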